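(* Let $k$ be a field and $A=k[t]$ the univariate polynomial algebra over $k$. For any $k$-subspace $V$ of $A$, $V$ is a Mathieu subspace of $A$ if and only if $\mathfrak r(V)=\mathfrak r(I_V)$.
   Context: For a subset $V$ of a commutative algebra $A$, the radical is $\mathfrak r(V)=\{a\in A : \text{there exists } N \text{ such that } a^m\in V \text{ for all } m\ge N\}$. A $k$-subspace $V$ of a commutative $k$-algebra $A$ is a Mathieu subspace of $A$ if for every $a\in\mathfrak r(V)$ and every $b\in A$ there exists $N$ (depending on $a$ and $b$) such that $a^m b\in V$ for all $m\ge N$. For a $k$-subspace $V$ of $A$, $I_V$ denotes the largest ideal of $A$ contained in $V$ (the sum of all ideals of $A$ contained in $V$). *)

theory Defs
  imports "HOL-Computational_Algebra.Polynomial"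
begin

definition radical :: "'a::comm_ring_1 set \<Rightarrow> 'a set" where
  "radical V = {a. \<exists>N. \<forall>m\<ge>N. a ^ m \<in> V}"

text \<open>
  A commutative ring is a module over itself, and its ideals are the submodules.
\<close>

lemma module_self: "module ((*) :: 'a::comm_ring_1 \<Rightarrow> 'a \<Rightarrow> 'a)"
proof
  fix a b x y :: 'a
  show "a * (x + y) = a * x + a * y" by (rule distrib_left)
  show "(a + b) * x = a * x + b * x" by (rule distrib_right)
  show "a * (b * x) = a * b * x" by (rule mult.assoc[symmetric])
  show "1 * x = x" by (rule mult_1_left)
qed

abbreviation is_ideal :: "'a::comm_ring_1 set \<Rightarrow> bool" where
  "is_ideal \<equiv> module.subspace (*)"

text \<open>
  The sum of a family of submodules is the submodule generated by their union. The lemmas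
  below confirm that, for \<open>V\<close> containing \<open>0\<close> and closed under addition, this is the largest
  ideal contained in \<open>V\<close>.
\<close>

definition largest_ideal :: "'a::comm_ring_1 set \<Rightarrow> 'a set" where
  "largest_ideal V = module.span (*) (\<Union>{I. is_ideal I \<and> I \<subseteq> V})"

lemma is_ideal_largest_ideal: "is_ideal (largest_ideal V)"
  unfolding largest_ideal_def by (rule module.subspace_span[OF module_self])

lemma largest_ideal_greatest:
  assumes "is_ideal I" "I \<subseteq> V"
  shows "I \<subseteq> largest_ideal V"
  unfolding largest_ideal_def by (rule subset_trans[OF _ module.span_superset[OF module_self]]) (use assms in auto)

lemma largest_ideal_subset:
  assumes zero: "0 \<in> V" and add: "\<And>x y. x \<in> V \<Longrightarrow> y \<in> V \<Longrightarrow> x + y \<in> V"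
  shows "largest_ideal V \<subseteq> V"
proof
  fix x assume "x \<in> largest_ideal V"
  then have "x \<in> module.span (*) (\<Union>{I. is_ideal I \<and> I \<subseteq> V})"
    by (simp only: largest_ideal_def)
  then show "x \<in> V"
  proof (induction rule: module.span_induct_alt[OF module_self, consumes 1, case_names base step])
    case base
    show ?case by (rule zero)
  next
    case (step c x y)
    then obtain I where I: "is_ideal I" "I \<subseteq> V" "x \<in> I" by auto
    have "c * x \<in> I"
      by (rule module.subspace_scale[OF module_self I(1) I(3)])
    then have "c * x \<in> V"
      using I(2) by (rule rev_subsetD)
    then show ?case using step(2) by (rule add)
  qed
qed

locale commutative_algebra = vector_space scale
  for scale :: "'k::field \<Rightarrow> 'a::comm_ring_1 \<Rightarrow> 'a" +
  assumes scale_mult_left: "scale c x * y = scale c (x * y)"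
begin

definition mathieu_subspace :: "'a set \<Rightarrow> bool" where
  "mathieu_subspace V \<longleftrightarrow>
     subspace V \<and> (\<forall>a\<in>radical V. \<forall>b. \<exists>N. \<forall>m\<ge>N. a ^ m * b \<in> V)"

end

lemma commutative_algebra_smult:
  "commutative_algebra (smult :: 'k::field \<Rightarrow> 'k poly \<Rightarrow> 'k poly)"
proof
  fix a b :: 'k and x y :: "'k poly"
  show "smult a (x + y) = smult a x + smult a y" by (rule smult_add_right)
  show "smult (a + b) x = smult a x + smult b x" by (rule smult_add_left)
  show "smult a (smult b x) = smult (a * b) x" by (rule smult_smult)
  show "smult 1 x = x" by (rule smult_1_left)
  show "smult a x * y = smult a (x * y)" by (rule mult_smult_left)
qed

end

theory Submission
  imports Defs
begin

text \<open>
  If a power of \<open>a\<close> lies in an ideal inside \<open>V\<close>, so do all its multiples; hence equality of the two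
  radicals implies the Mathieu property in every commutative algebra. The converse is where
  univariate polynomials enter: \<open>k[t]\<close> is finite over the subalgebra \<open>k[a]\<close> for every nonconstant
  polynomial \<open>a\<close>, being spanned over it by \<open>1, t, \<dots>, t\<^bsup>d-1\<^esup>\<close> with \<open>d\<close> the degree of \<open>a\<close>.
  For \<open>a\<close> in the radical of a Mathieu subspace \<open>V\<close>, the bound \<open>N\<close> from which on
  \<open>a\<^sup>m b \<in> V\<close> depends on \<open>b\<close>; but a single bound serves the finitely many generators
  \<open>b = t\<^sup>i\<close>. The elements \<open>a\<^sup>m t\<^sup>i\<close> with \<open>m \<ge> N\<close> and \<open>i < d\<close> span the whole ideal generated by
  \<open>a\<^sup>N\<close>, so that this ideal is contained in \<open>V\<close> (lemma \<open>uniform_multiplier_bound\<close>). A constant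
  \<open>a\<close> is zero or a unit of \<open>k\<close>, and powers of a unit of \<open>k\<close> can be cancelled in \<open>V\<close>.
\<close>

lemma largest_ideal_memI:
  fixes x :: "'a::comm_ring_1"
  assumes "\<And>b. x * b \<in> V"
  shows "x \<in> largest_ideal V"
proof -
  interpret module "(*) :: 'a \<Rightarrow> 'a \<Rightarrow> 'a"
    by (rule module_self)
  have "subspace (range ((*) x))"
  proof (rule subspaceI)
    show "0 \<in> range ((*) x)"
      by (rule range_eqI[of _ _ 0]) simp
    show "u + v \<in> range ((*) x)" if "u \<in> range ((*) x)" "v \<in> range ((*) x)" for u v
      using that by (auto simp flip: distrib_left)
    show "c * u \<in> range ((*) x)" if "u \<in> range ((*) x)" for c u
      using that by (metis (no_types, lifting) mult.left_commute image_iff rangeI)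
  qed
  moreover have "range ((*) x) \<subseteq> V"
    using assms by auto
  ultimately have "range ((*) x) \<subseteq> largest_ideal V"
    by (rule largest_ideal_greatest)
  moreover have "x \<in> range ((*) x)"
    by (rule range_eqI[of _ _ 1]) simp
  ultimately show ?thesis ..
qed

lemma radical_mono: "U \<subseteq> V \<Longrightarrow> radical U \<subseteq> radical V"
  unfolding radical_def by blast

lemma (in commutative_algebra) largest_ideal_subset_subspace:
  "subspace V \<Longrightarrow> largest_ideal V \<subseteq> V"
  by (rule largest_ideal_subset) (auto intro: subspace_0 subspace_add)

lemma (in commutative_algebra) mathieu_subspace_if_radical_subset:
  assumes V: "subspace V" and rad: "radical V \<subseteq> radical (largest_ideal V)"
  shows "mathieu_subspace V"
  unfolding mathieu_subspace_def
proof (intro conjI V ballI allI)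
  fix a b assume "a \<in> radical V"
  with rad obtain N where N: "\<forall>m\<ge>N. a ^ m \<in> largest_ideal V"
    unfolding radical_def by blast
  have "a ^ m * b \<in> V" if "m \<ge> N" for m
    using module.subspace_scale[OF module_self is_ideal_largest_ideal, of "a ^ m" V b] N that
      largest_ideal_subset_subspace[OF V] by (auto simp: mult.commute)
  then show "\<exists>N. \<forall>m\<ge>N. a ^ m * b \<in> V"
    by blast
qed

text \<open>
  Division by \<open>a\<close> with remainder is what makes \<open>k[t]\<close> generated over \<open>k[a]\<close> by the polynomials of
  smaller degree: a quotient by \<open>a\<close> is multiplied by one more power of \<open>a\<close>, which the assumption
  permits because it covers all exponents above \<open>N\<close>.
\<close>
lemma power_mult_mem_of_small_degree:
  fixes a b :: "'k::field poly"
  assumes V: "module.subspace smult V"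
    and a: "degree a > 0"
    and small: "\<And>m r. m \<ge> N \<Longrightarrow> degree r < degree a \<Longrightarrow> a ^ m * r \<in> V"
    and m: "m \<ge> N"
  shows "a ^ m * b \<in> V"
  using m
proof (induction "degree b" arbitrary: b m rule: less_induct)
  case less
  interpret commutative_algebra "smult :: 'k \<Rightarrow> 'k poly \<Rightarrow> 'k poly"
    by (rule commutative_algebra_smult)
  show ?case
  proof (cases "degree b < degree a")
    case True
    then show ?thesis
      using small less.prems by blast
  next
    case False
    have "a ^ Suc m * (b div a) \<in> V"
      using less.prems a False by (intro less.hyps degree_div_less) auto
    moreover have "a ^ m * (b mod a) \<in> V"
      using less.prems a degree_mod_less'[of a b] by (intro small) (cases "b mod a = 0"; force)+
    ultimately have "a ^ Suc m * (b div a) + a ^ m * (b mod a) \<in> V"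
      by (rule subspace_add[OF V])
    also have "a ^ Suc m * (b div a) + a ^ m * (b mod a) = a ^ m * (b div a * a + b mod a)"
      by (simp only: power_Suc distrib_left mult_ac)
    finally show ?thesis
      by (simp only: div_mult_mod_eq)
  qed
qed

text \<open>
  The exponent bound in the definition of a Mathieu subspace depends on the multiplier \<open>b\<close>; in
  \<open>k[t]\<close> it can be chosen uniformly, since only the multipliers \<open>t\<^sup>i\<close> below the degree of \<open>a\<close> matter.
\<close>
lemma uniform_multiplier_bound:
  fixes a :: "'k::field poly"
  assumes V: "commutative_algebra.mathieu_subspace smult V"
    and a: "a \<in> radical V"
  shows "\<exists>N. \<forall>m\<ge>N. \<forall>b. a ^ m * b \<in> V"
proof -
  interpret commutative_algebra "smult :: 'k \<Rightarrow> 'k poly \<Rightarrow> 'k poly"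
    by (rule commutative_algebra_smult)
  have sub: "subspace V"
    and ev: "\<And>b. eventually (\<lambda>m. a ^ m * b \<in> V) sequentially"
    using V a by (auto simp: mathieu_subspace_def eventually_sequentially)
  show ?thesis
  proof (cases "degree a = 0")
    case True
    then obtain c where c: "a = [:c:]"
      by (rule degree_eq_zeroE)
    have "a ^ m * b \<in> V" if "m \<ge> 1" for m b
    proof (cases "c = 0")
      case True
      then show ?thesis
        using that subspace_0[OF sub] by (simp add: c power_0_left)
    next
      case False
      obtain n where "smult (c ^ n) b \<in> V"
        using ev[of b] by (auto simp: c poly_const_pow eventually_sequentially)
      then have "smult (c ^ m / c ^ n) (smult (c ^ n) b) \<in> V"
        by (rule subspace_scale[OF sub])
      then show ?thesis
        using False by (simp add: c poly_const_pow)
    qed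
    then show ?thesis
      by blast
  next
    case False
    have "eventually (\<lambda>m. \<forall>i\<in>{..<degree a}. a ^ m * monom 1 i \<in> V) sequentially"
      using ev by (intro eventually_ball_finite) auto
    then obtain N where N: "\<And>m i. m \<ge> N \<Longrightarrow> i < degree a \<Longrightarrow> a ^ m * monom 1 i \<in> V"
      by (auto simp: eventually_sequentially)
    have "a ^ m * r \<in> V" if "m \<ge> N" "degree r < degree a" for m r
    proof -
      have "a ^ m * r = a ^ m * (\<Sum>i\<le>degree r. monom (coeff r i) i)"
        by (simp only: poly_as_sum_of_monoms)
      also have "\<dots> = (\<Sum>i\<le>degree r. smult (coeff r i) (a ^ m * monom 1 i))"
        by (simp add: sum_distrib_left smult_monom flip: mult_smult_right)
      also have "\<dots> \<in> V"
        using that by (intro subspace_sum[OF sub] subspace_scale[OF sub] N) auto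
      finally show ?thesis .
    qed
    then show ?thesis
      using power_mult_mem_of_small_degree[OF sub, of a N] False by blast
  qed
qed

theorem theorem4p1:
  fixes V :: "'k::field poly set"
  assumes "module.subspace smult V"
  shows "commutative_algebra.mathieu_subspace smult V \<longleftrightarrow> radical V = radical (largest_ideal V)"
proof -
  interpret commutative_algebra "smult :: 'k \<Rightarrow> 'k poly \<Rightarrow> 'k poly"
    by (rule commutative_algebra_smult)
  show ?thesis
  proof
    assume V: "mathieu_subspace V"
    have "a \<in> radical (largest_ideal V)" if a: "a \<in> radical V" for a
    proof -
      obtain N where "\<And>m b. m \<ge> N \<Longrightarrow> a ^ m * b \<in> V"
        using uniform_multiplier_bound[OF V a] by blast
      then show ?thesis
        unfolding radical_def by (blast intro: largest_ideal_memI)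
    qed
    then show "radical V = radical (largest_ideal V)"
      using radical_mono[OF largest_ideal_subset_subspace[OF assms]] by blast
  next
    assume "radical V = radical (largest_ideal V)"
    then show "mathieu_subspace V"
      using mathieu_subspace_if_radical_subset[OF assms] by blast
  qed
qed

end
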